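(* Let $G=L\wr P$ be a product type primitive group on $\Omega=\Gamma^k$, where $L\leqslant\mathrm{Sym}(\Gamma)$ and $P\leqslant S_k$. Then $$r(G)=\frac{1}{|P|}\sum_{m=D(P)}^{k} m!\binom{r(L)}{m}t_m.$$
   Context: **Product type.** $G=L\wr P$ is a product type primitive group if $k\geqslant 2$, $P\leqslant S_k$ is transitive, $L\leqslant \mathrm{Sym}(\Gamma)$ is a finite primitive group that is either almost simple or of diagonal type (in the sense of the O'Nan–Scott theorem), and $G$ acts on $\Omega=\Gamma^k$ with its product action. **Notation.** For a transitive permutation group $X$, $r(X)$ is the number of regular suborbits of $X$, i.e. the number of regular orbits of a point stabiliser. A partition of $\{1,\dots,k\}$ into non-empty parts is a distinguishing partition for $P$ if the intersection of the setwise stabilisers in $P$ of its parts is trivial. $D(P)$ is the minimal number of parts in a distinguishing partition for $P$, and $t_m$ is the number of (unordered) distinguishing partitions for $P$ with exactly $m$ non-empty parts. *)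

theory Defs
  imports
    "HOL-Algebra.Group_Action"
    "HOL-Algebra.SimpleGroups"
    "HOL-Library.Disjoint_Sets"
    Complex_Main
begin

section \<open>Permutation groups and regular suborbits\<close>

text \<open>
  A permutation group on \<open>E\<close> is a subgroup \<open>L\<close> of \<^term>\<open>BijGroup E\<close>; it acts on \<open>E\<close>
  through \<open>\<lambda>g. g\<close>. All actions are left actions.
\<close>

definition perm_group :: "'a set \<Rightarrow> ('a \<Rightarrow> 'a) set \<Rightarrow> ('a \<Rightarrow> 'a) monoid" where
  "perm_group E L = BijGroup E \<lparr>carrier := L\<rparr>"

definition primitive_action ::
    "('g, 'm) monoid_scheme \<Rightarrow> 'e set \<Rightarrow> ('g \<Rightarrow> 'e \<Rightarrow> 'e) \<Rightarrow> bool" where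
  "primitive_action G E \<phi> \<longleftrightarrow>
     transitive_action G E \<phi> \<and>
     (\<forall>\<Q>. partition_on E \<Q> \<and> (\<forall>g\<in>carrier G. \<forall>B\<in>\<Q>. \<phi> g ` B \<in> \<Q>)
          \<longrightarrow> \<Q> = {E} \<or> \<Q> = (\<lambda>x. {x}) ` E)"

definition regular_orbits ::
    "('g, 'm) monoid_scheme \<Rightarrow> 'e set \<Rightarrow> ('g \<Rightarrow> 'e \<Rightarrow> 'e) \<Rightarrow> 'e set set" where
  "regular_orbits H E \<phi> =
     {\<Delta> \<in> orbits H E \<phi>. \<forall>x\<in>\<Delta>. stabilizer H \<phi> x = {\<one>\<^bsub>H\<^esub>}}"

definition regular_suborbits ::
    "('g, 'm) monoid_scheme \<Rightarrow> 'e set \<Rightarrow> ('g \<Rightarrow> 'e \<Rightarrow> 'e) \<Rightarrow> 'e \<Rightarrow> 'e set set" where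
  "regular_suborbits G E \<phi> \<alpha> =
     regular_orbits (G \<lparr>carrier := stabilizer G \<phi> \<alpha>\<rparr>) E \<phi>"

text \<open>
  For a transitive action the choice of the base point is immaterial, see the lemma
  \<open>num_regular_suborbits_eq\<close> below.
\<close>

definition num_regular_suborbits ::
    "('g, 'm) monoid_scheme \<Rightarrow> 'e set \<Rightarrow> ('g \<Rightarrow> 'e \<Rightarrow> 'e) \<Rightarrow> nat" where
  "num_regular_suborbits G E \<phi> = card (regular_suborbits G E \<phi> (SOME \<alpha>. \<alpha> \<in> E))"

lemma (in group_action) regular_suborbits_image:
  assumes \<alpha>: "\<alpha> \<in> E" and g: "g \<in> carrier G" and \<Delta>: "\<Delta> \<in> regular_suborbits G E \<phi> \<alpha>"
  shows "\<phi> g ` \<Delta> \<in> regular_suborbits G E \<phi> (\<phi> g \<alpha>)"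
proof -
  interpret G: group G using group_hom group_hom.axioms(1) by auto
  define c where "c h = g \<otimes> h \<otimes> inv g" for h
  define d where "d h = inv g \<otimes> h \<otimes> g" for h
  have cc: "c h \<in> carrier G" "d h \<in> carrier G" if "h \<in> carrier G" for h
    using that g by (auto simp: c_def d_def)
  have invg: "\<phi> (inv g) (\<phi> g x) = x" if "x \<in> E" for x
    using orbit_sym_aux[OF g that refl] .
  have gx: "\<phi> h x \<in> E" if "x \<in> E" "h \<in> carrier G" for x h
    using element_image[OF that(2,1) refl] .
  have c_act: "\<phi> (c h) (\<phi> g x) = \<phi> g (\<phi> h x)" if "x \<in> E" "h \<in> carrier G" for x h
    unfolding c_def using that g
    by (simp add: composition_rule gx invg del: G.m_assoc)
  have cd: "c (d h) = h" if "h \<in> carrier G" for h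
    using that g by (simp add: c_def d_def G.m_assoc flip: G.m_assoc[of g "inv g"])
  have inj: "\<phi> g x = \<phi> g y \<Longrightarrow> x = y" if "x \<in> E" "y \<in> E" for x y
    using inj_prop[OF g] that by (auto dest: inj_onD)
  have stab: "stabilizer G \<phi> (\<phi> g x) = c ` stabilizer G \<phi> x" if x: "x \<in> E" for x
  proof
    show "c ` stabilizer G \<phi> x \<subseteq> stabilizer G \<phi> (\<phi> g x)"
      using x by (auto simp: stabilizer_def cc c_act)
    show "stabilizer G \<phi> (\<phi> g x) \<subseteq> c ` stabilizer G \<phi> x"
    proof
      fix h assume "h \<in> stabilizer G \<phi> (\<phi> g x)"
      then have h: "h \<in> carrier G" "\<phi> h (\<phi> g x) = \<phi> g x" by (auto simp: stabilizer_def)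
      then have "\<phi> g (\<phi> (d h) x) = \<phi> g x"
        using c_act[OF x cc(2)[OF h(1)]] cd by simp
      then have "\<phi> (d h) x = x" using inj gx x cc(2) h(1) by blast
      then have "d h \<in> stabilizer G \<phi> x" using cc h by (auto simp: stabilizer_def)
      then show "h \<in> c ` stabilizer G \<phi> x" using cd[OF h(1)] by force
    qed
  qed
  let ?H = "G \<lparr>carrier := stabilizer G \<phi> \<alpha>\<rparr>"
  let ?K = "G \<lparr>carrier := stabilizer G \<phi> (\<phi> g \<alpha>)\<rparr>"
  have orb: "orbit ?K \<phi> (\<phi> g x) = \<phi> g ` orbit ?H \<phi> x" if x: "x \<in> E" for x
  proof -
    have "orbit ?K \<phi> (\<phi> g x) = (\<lambda>h. \<phi> (c h) (\<phi> g x)) ` stabilizer G \<phi> \<alpha>"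
      by (auto simp: orbit_def stab[OF \<alpha>])
    also have "\<dots> = (\<lambda>h. \<phi> g (\<phi> h x)) ` stabilizer G \<phi> \<alpha>"
      using x by (intro image_cong refl) (auto simp: c_act stabilizer_def)
    finally show ?thesis by (auto simp: orbit_def)
  qed
  from \<Delta> obtain x where x: "x \<in> E" and \<Delta>x: "\<Delta> = orbit ?H \<phi> x"
    and reg: "\<And>y. y \<in> \<Delta> \<Longrightarrow> stabilizer ?H \<phi> y = {\<one>}"
    by (auto simp: regular_suborbits_def regular_orbits_def orbits_def)
  have \<Delta>E: "y \<in> E" if "y \<in> \<Delta>" for y
    using that x gx by (auto simp: \<Delta>x orbit_def stabilizer_def)
  have "\<phi> g ` \<Delta> \<in> orbits ?K E \<phi>"
    using orb[OF x] \<Delta>x gx[OF x g] by (auto simp: orbits_def)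
  moreover have "stabilizer ?K \<phi> (\<phi> g y) = {\<one>}" if y: "y \<in> \<Delta>" for y
  proof -
    have "stabilizer ?K \<phi> (\<phi> g y) = stabilizer G \<phi> (\<phi> g \<alpha>) \<inter> stabilizer G \<phi> (\<phi> g y)"
      by (auto simp: stabilizer_def)
    also have "\<dots> = c ` stabilizer ?H \<phi> y"
    proof -
      have "inj_on c (carrier G)"
        using g by (auto simp: inj_on_def c_def)
      then have "c ` (stabilizer G \<phi> \<alpha> \<inter> stabilizer G \<phi> y)
                 = c ` stabilizer G \<phi> \<alpha> \<inter> c ` stabilizer G \<phi> y"
        by (rule inj_on_image_Int) (auto simp: stabilizer_def)
      moreover have "stabilizer ?H \<phi> y = stabilizer G \<phi> \<alpha> \<inter> stabilizer G \<phi> y"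
        by (auto simp: stabilizer_def)
      ultimately show ?thesis using stab[OF \<alpha>] stab[OF \<Delta>E[OF y]] by simp
    qed
    also have "\<dots> = {\<one>}" using reg[OF y] g by (simp add: c_def)
    finally show ?thesis .
  qed
  ultimately show ?thesis
    by (auto simp: regular_suborbits_def regular_orbits_def)
qed

lemma (in transitive_action) num_regular_suborbits_eq:
  assumes \<alpha>: "\<alpha> \<in> E"
  shows "num_regular_suborbits G E \<phi> = card (regular_suborbits G E \<phi> \<alpha>)"
proof -
  interpret G: group G using group_hom group_hom.axioms(1) by auto
  define \<beta> where "\<beta> = (SOME \<beta>. \<beta> \<in> E)"
  have \<beta>: "\<beta> \<in> E" unfolding \<beta>_def using \<alpha> by (rule someI)
  obtain g where g: "g \<in> carrier G" and g\<beta>: "\<phi> g \<beta> = \<alpha>" using unique_orbit[OF \<beta> \<alpha>] by blast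
  have g\<alpha>: "\<phi> (inv g) \<alpha> = \<beta>" using orbit_sym_aux[OF g \<beta> g\<beta>] .
  have sub: "\<Delta> \<subseteq> E" if "\<Delta> \<in> regular_suborbits G E \<phi> \<gamma>" for \<Delta> \<gamma>
    using that element_image
    by (fastforce simp: regular_suborbits_def regular_orbits_def orbits_def orbit_def
                        stabilizer_def)
  have c1: "\<phi> (inv g) ` \<phi> g ` \<Delta> = \<Delta>" if "\<Delta> \<subseteq> E" for \<Delta>
    using that orbit_sym_aux[OF g _ refl] by (force simp: image_image)
  have c2: "\<phi> g ` \<phi> (inv g) ` \<Delta> = \<Delta>" if "\<Delta> \<subseteq> E" for \<Delta>
    using that orbit_sym_aux[OF G.inv_closed[OF g] _ refl] g by (force simp: image_image)
  have "bij_betw (\<lambda>\<Delta>. \<phi> g ` \<Delta>) (regular_suborbits G E \<phi> \<beta>) (regular_suborbits G E \<phi> \<alpha>)"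
  proof (rule bij_betw_byWitness[where f' = "\<lambda>\<Delta>. \<phi> (inv g) ` \<Delta>"])
    show "\<forall>\<Delta>\<in>regular_suborbits G E \<phi> \<beta>. \<phi> (inv g) ` \<phi> g ` \<Delta> = \<Delta>"
      by (intro ballI c1) (rule sub)
    show "\<forall>\<Delta>\<in>regular_suborbits G E \<phi> \<alpha>. \<phi> g ` \<phi> (inv g) ` \<Delta> = \<Delta>"
      by (intro ballI c2) (rule sub)
    show "(\<lambda>\<Delta>. \<phi> g ` \<Delta>) ` regular_suborbits G E \<phi> \<beta> \<subseteq> regular_suborbits G E \<phi> \<alpha>"
      using regular_suborbits_image[OF \<beta> g] g\<beta> by auto
    show "(\<lambda>\<Delta>. \<phi> (inv g) ` \<Delta>) ` regular_suborbits G E \<phi> \<alpha> \<subseteq> regular_suborbits G E \<phi> \<beta>"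
      using regular_suborbits_image[OF \<alpha> G.inv_closed[OF g]] g\<alpha> by auto
  qed
  then show ?thesis
    unfolding num_regular_suborbits_def \<beta>_def[symmetric] by (rule bij_betw_same_card)
qed


section \<open>Wreath products and the product action\<close>

definition wreath_product ::
    "'i set \<Rightarrow> ('g, 'm) monoid_scheme \<Rightarrow> ('i \<Rightarrow> 'i) set \<Rightarrow> (('i \<Rightarrow> 'g) \<times> ('i \<Rightarrow> 'i)) monoid" where
  "wreath_product I A P =
     \<lparr>carrier = (I \<rightarrow>\<^sub>E carrier A) \<times> P,
      monoid.mult = (\<lambda>(f, \<sigma>) (g, \<tau>). (\<lambda>i\<in>I. f i \<otimes>\<^bsub>A\<^esub> g (inv_into I \<sigma> i), compose I \<sigma> \<tau>)),
      one = (\<lambda>i\<in>I. \<one>\<^bsub>A\<^esub>, \<lambda>i\<in>I. i)\<rparr>"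

definition product_action ::
    "'i set \<Rightarrow> 'a set \<Rightarrow> ('i \<Rightarrow> 'a \<Rightarrow> 'a) \<times> ('i \<Rightarrow> 'i) \<Rightarrow> ('i \<Rightarrow> 'a) \<Rightarrow> 'i \<Rightarrow> 'a" where
  "product_action I \<Gamma> = (\<lambda>(f, \<sigma>). \<lambda>\<omega> \<in> I \<rightarrow>\<^sub>E \<Gamma>. \<lambda>i\<in>I. f i (\<omega> (inv_into I \<sigma> i)))"

lemma group_wreath_product:
  assumes A: "group A" and P: "subgroup P (BijGroup I)"
  shows "group (wreath_product I A P)"
proof -
  interpret A: group A by (rule A)
  interpret P: subgroup P "BijGroup I" by (rule P)
  have B: "\<sigma> \<in> Bij I" if "\<sigma> \<in> P" for \<sigma>
    using that P.subset by (auto simp: BijGroup_def)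
  have PI: "compose I \<sigma> \<tau> \<in> P" if "\<sigma> \<in> P" "\<tau> \<in> P" for \<sigma> \<tau>
    using P.m_closed[OF that] that B by (simp add: BijGroup_def)
  have P1: "(\<lambda>i\<in>I. i) \<in> P" using P.one_closed by (simp add: BijGroup_def)
  have Pinv: "(\<lambda>i\<in>I. inv_into I \<sigma> i) \<in> P" if "\<sigma> \<in> P" for \<sigma>
    using P.m_inv_closed[OF that] inv_BijGroup[OF B[OF that]] by simp
  have ext: "\<sigma> \<in> extensional I" and bij: "bij_betw \<sigma> I I" if "\<sigma> \<in> P" for \<sigma>
    using B[OF that] by (auto simp: Bij_def)
  have invI: "inv_into I \<sigma> i \<in> I" if "\<sigma> \<in> P" "i \<in> I" for \<sigma> i
    using B[OF that(1)] that(2) by (rule Bij_inv_into_mem)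
  have im: "\<sigma> i \<in> I" if "\<sigma> \<in> P" "i \<in> I" for \<sigma> i
    using bij[OF that(1)] that(2) by (auto simp: bij_betw_def)
  have inv_l: "inv_into I \<sigma> (\<sigma> i) = i" if "\<sigma> \<in> P" "i \<in> I" for \<sigma> i
    using bij[OF that(1)] that(2) by (simp add: bij_betw_def)
  have inv_r: "\<sigma> (inv_into I \<sigma> i) = i" if "\<sigma> \<in> P" "i \<in> I" for \<sigma> i
    using bij[OF that(1)] that(2) by (simp add: bij_betw_inv_into_right)
  have inv_comp: "inv_into I (compose I \<sigma> \<tau>) i = inv_into I \<tau> (inv_into I \<sigma> i)"
    if "\<sigma> \<in> P" "\<tau> \<in> P" "i \<in> I" for \<sigma> \<tau> i
    by (rule inv_into_f_eq)
       (use that bij[OF PI[OF that(1,2)]] in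
         \<open>auto simp: bij_betw_def compose_def invI inv_r\<close>)
  have inv_id: "inv_into I (\<lambda>i\<in>I. i) i = i" if "i \<in> I" for i
    by (rule inv_into_f_eq) (use that in \<open>auto simp: inj_on_def\<close>)
  show ?thesis
  proof (rule groupI, goal_cases)
    case (1 x y)
    then show ?case
      by (auto simp: wreath_product_def PI invI PiE_iff split: prod.splits)
  next
    case 2
    then show ?case by (auto simp: wreath_product_def P1)
  next
    case (3 x y z)
    obtain f \<sigma> where x: "x = (f, \<sigma>)" by (cases x)
    obtain g \<tau> where y: "y = (g, \<tau>)" by (cases y)
    obtain h \<rho> where z: "z = (h, \<rho>)" by (cases z)
    have mem: "\<sigma> \<in> P" "\<tau> \<in> P" "\<rho> \<in> P"
      and fgh: "\<And>i. i \<in> I \<Longrightarrow> f i \<in> carrier A" "\<And>i. i \<in> I \<Longrightarrow> g i \<in> carrier A"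
        "\<And>i. i \<in> I \<Longrightarrow> h i \<in> carrier A"
      using 3 by (auto simp: wreath_product_def x y z)
    have "compose I (compose I \<sigma> \<tau>) \<rho> = compose I \<sigma> (compose I \<tau> \<rho>)"
      using mem im by (intro compose_assoc[symmetric]) auto
    then show ?case
      using mem fgh
      by (auto simp: wreath_product_def x y z invI inv_comp A.m_assoc intro!: restrict_ext)
  next
    case (4 x)
    obtain f \<sigma> where x: "x = (f, \<sigma>)" by (cases x)
    have mem: "\<sigma> \<in> P" and f: "f \<in> I \<rightarrow>\<^sub>E carrier A" using 4 by (auto simp: wreath_product_def x)
    have "(\<lambda>i\<in>I. \<one>\<^bsub>A\<^esub> \<otimes>\<^bsub>A\<^esub> f (inv_into I (\<lambda>i\<in>I. i) i)) = f"
      using f by (auto simp: fun_eq_iff inv_id PiE_def Pi_iff extensional_def)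
    moreover have "compose I (\<lambda>i\<in>I. i) \<sigma> = \<sigma>"
      using im[OF mem] ext[OF mem] by (intro Id_compose) auto
    ultimately show ?case by (simp add: wreath_product_def x cong: restrict_cong)
  next
    case (5 x)
    obtain f \<sigma> where x: "x = (f, \<sigma>)" by (cases x)
    have mem: "\<sigma> \<in> P" and f: "\<And>i. i \<in> I \<Longrightarrow> f i \<in> carrier A"
      using 5 by (auto simp: wreath_product_def x)
    let ?\<tau> = "\<lambda>i\<in>I. inv_into I \<sigma> i"
    let ?y = "(\<lambda>i\<in>I. inv\<^bsub>A\<^esub> f (\<sigma> i), ?\<tau>)"
    have inv_\<tau>: "inv_into I ?\<tau> i = \<sigma> i" if "i \<in> I" for i
      by (rule inv_into_f_eq)
         (use that mem bij[OF Pinv[OF mem]] in \<open>auto simp: bij_betw_def im inv_l\<close>)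
    have "?y \<in> carrier (wreath_product I A P)"
      using mem f Pinv im by (auto simp: wreath_product_def)
    moreover have "compose I ?\<tau> \<sigma> = (\<lambda>i\<in>I. i)"
      using mem by (auto simp: compose_def im inv_l fun_eq_iff)
    then have "?y \<otimes>\<^bsub>wreath_product I A P\<^esub> x = \<one>\<^bsub>wreath_product I A P\<^esub>"
      using mem f by (auto simp: wreath_product_def x inv_\<tau> im intro!: restrict_ext)
    ultimately show ?case by blast
  qed
qed

lemma group_action_product_action:
  assumes L: "subgroup L (BijGroup \<Gamma>)" and P: "subgroup P (BijGroup I)"
  shows "group_action (wreath_product I (perm_group \<Gamma> L) P) (I \<rightarrow>\<^sub>E \<Gamma>) (product_action I \<Gamma>)"
proof -
  interpret P: subgroup P "BijGroup I" by (rule P)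
  interpret L: subgroup L "BijGroup \<Gamma>" by (rule L)
  let ?W = "wreath_product I (perm_group \<Gamma> L) P" and ?E = "I \<rightarrow>\<^sub>E \<Gamma>" and ?\<phi> = "product_action I \<Gamma>"
  have gL: "group (perm_group \<Gamma> L)"
    unfolding perm_group_def by (rule L.subgroup_is_group[OF group_BijGroup])
  interpret W: group ?W by (rule group_wreath_product[OF gL P])
  have B: "\<sigma> \<in> Bij I" if "\<sigma> \<in> P" for \<sigma>
    using that P.subset by (auto simp: BijGroup_def)
  have BL: "f \<in> Bij \<Gamma>" if "f \<in> L" for f
    using that L.subset by (auto simp: BijGroup_def)
  have fL: "f x \<in> \<Gamma>" if "f \<in> L" "x \<in> \<Gamma>" for f x
    using BL[OF that(1)] that(2) by (auto simp: Bij_def bij_betw_def)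
  have bij: "bij_betw \<sigma> I I" if "\<sigma> \<in> P" for \<sigma>
    using B[OF that] by (auto simp: Bij_def)
  have invI: "inv_into I \<sigma> i \<in> I" if "\<sigma> \<in> P" "i \<in> I" for \<sigma> i
    using B[OF that(1)] that(2) by (rule Bij_inv_into_mem)
  have inv_r: "\<sigma> (inv_into I \<sigma> i) = i" if "\<sigma> \<in> P" "i \<in> I" for \<sigma> i
    using bij[OF that(1)] that(2) by (simp add: bij_betw_inv_into_right)
  have PI: "compose I \<sigma> \<tau> \<in> P" if "\<sigma> \<in> P" "\<tau> \<in> P" for \<sigma> \<tau>
    using P.m_closed[OF that] that B by (simp add: BijGroup_def)
  have inv_comp: "inv_into I (compose I \<sigma> \<tau>) i = inv_into I \<tau> (inv_into I \<sigma> i)"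
    if "\<sigma> \<in> P" "\<tau> \<in> P" "i \<in> I" for \<sigma> \<tau> i
    by (rule inv_into_f_eq)
       (use that bij[OF PI[OF that(1,2)]] in
         \<open>auto simp: bij_betw_def compose_def invI inv_r\<close>)
  have inv_id: "inv_into I (\<lambda>i\<in>I. i) i = i" if "i \<in> I" for i
    by (rule inv_into_f_eq) (use that in \<open>auto simp: inj_on_def\<close>)
  have closed: "?\<phi> x \<omega> \<in> ?E" if "x \<in> carrier ?W" "\<omega> \<in> ?E" for x \<omega>
    using that fL invI
    by (cases x) (auto simp: product_action_def wreath_product_def perm_group_def PiE_iff)
  have mult: "?\<phi> (x \<otimes>\<^bsub>?W\<^esub> y) = compose ?E (?\<phi> x) (?\<phi> y)"
    if xy: "x \<in> carrier ?W" "y \<in> carrier ?W" for x y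
  proof -
    obtain f \<sigma> where x: "x = (f, \<sigma>)" by (cases x)
    obtain g \<tau> where y: "y = (g, \<tau>)" by (cases y)
    have mem: "\<sigma> \<in> P" "\<tau> \<in> P" "\<And>i. i \<in> I \<Longrightarrow> f i \<in> L" "\<And>i. i \<in> I \<Longrightarrow> g i \<in> L"
      using xy by (auto simp: wreath_product_def perm_group_def x y)
    have cmp: "(f i \<otimes>\<^bsub>BijGroup \<Gamma>\<^esub> g j) c = f i (g j c)" if "i \<in> I" "j \<in> I" "c \<in> \<Gamma>" for i j c
      using that mem BL by (simp add: BijGroup_def compose_def)
    have "?\<phi> (x \<otimes>\<^bsub>?W\<^esub> y) \<omega> = ?\<phi> x (?\<phi> y \<omega>)" if \<omega>: "\<omega> \<in> ?E" for \<omega>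
    proof -
      have "?\<phi> (x \<otimes>\<^bsub>?W\<^esub> y) \<omega> i = ?\<phi> x (?\<phi> y \<omega>) i" for i
        using closed[OF xy(2) \<omega>] \<omega> mem
        by (cases "i \<in> I")
           (auto simp: product_action_def wreath_product_def perm_group_def x y
                       invI inv_comp cmp PiE_iff)
      then show ?thesis by blast
    qed
    then show ?thesis
      by (auto simp: fun_eq_iff compose_def product_action_def split: prod.splits)
  qed
  have one: "?\<phi> \<one>\<^bsub>?W\<^esub> = (\<lambda>\<omega>\<in>?E. \<omega>)"
    by (auto simp: product_action_def wreath_product_def perm_group_def BijGroup_def inv_id
          PiE_iff extensional_def fun_eq_iff)
  have bijE: "?\<phi> x \<in> Bij ?E" if x: "x \<in> carrier ?W" for x
  proof -
    have ix: "inv\<^bsub>?W\<^esub> x \<in> carrier ?W" using x by simp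
    have "?\<phi> (inv\<^bsub>?W\<^esub> x) (?\<phi> x \<omega>) = \<omega>" if "\<omega> \<in> ?E" for \<omega>
      using fun_cong[OF mult[OF ix x], of \<omega>] that by (simp add: W.l_inv[OF x] one compose_def)
    moreover have "?\<phi> x (?\<phi> (inv\<^bsub>?W\<^esub> x) \<omega>) = \<omega>" if "\<omega> \<in> ?E" for \<omega>
      using fun_cong[OF mult[OF x ix], of \<omega>] that by (simp add: W.r_inv[OF x] one compose_def)
    ultimately have "bij_betw (?\<phi> x) ?E ?E"
      using closed[OF x] closed[OF ix]
      by (intro bij_betw_byWitness[where f' = "?\<phi> (inv\<^bsub>?W\<^esub> x)"]) blast+
    then show ?thesis
      by (cases x) (auto simp: Bij_def product_action_def)
  qed
  have "?\<phi> \<in> hom ?W (BijGroup ?E)"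
    by (rule homI) (auto simp: BijGroup_def bijE mult)
  then show ?thesis
    by (intro group_action.intro group_hom.intro group_hom_axioms.intro group_BijGroup W.is_group)
qed


section \<open>Almost simple groups and groups of diagonal type\<close>

definition inner_auts :: "('g, 'm) monoid_scheme \<Rightarrow> ('g \<Rightarrow> 'g) set" where
  "inner_auts T = {\<lambda>x\<in>carrier T. t \<otimes>\<^bsub>T\<^esub> x \<otimes>\<^bsub>T\<^esub> inv\<^bsub>T\<^esub> t | t. t \<in> carrier T}"

text \<open>
  Up to isomorphism, \<open>Inn T \<le> G \<le> Aut T\<close> for a finite non-abelian simple group \<open>T\<close>. Since \<open>T\<close>
  embeds in \<open>G\<close>, taking its elements from the type of those of \<open>G\<close> is no restriction.
\<close>

definition almost_simple :: "('g, 'm) monoid_scheme \<Rightarrow> bool" where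
  "almost_simple G \<longleftrightarrow>
     (\<exists>T :: 'g monoid. \<exists>h.
        simple_group T \<and> finite (carrier T) \<and> \<not> comm_group T \<and>
        h \<in> mon G (AutoGroup T) \<and> inner_auts T \<subseteq> h ` carrier G)"

text \<open>
  Diagonal type as in the O'Nan--Scott theorem of Liebeck, Praeger and Saxl:
  \<open>W = {(a\<^sub>1, \<dots>, a\<^sub>m) \<pi> \<in> Aut T \<wr> S\<^sub>m | all a\<^sub>i agree modulo Inn T} = T\<^sup>m . (Out T \<times> S\<^sub>m)\<close>
  acts on the cosets of \<open>D = {(a, \<dots>, a) \<pi>}\<close>, and the groups considered lie between
  \<open>(Inn T)\<^sup>m\<close> and \<open>W\<close>.
\<close>

definition diag_group ::
    "('g, 'm) monoid_scheme \<Rightarrow> nat \<Rightarrow> ((nat \<Rightarrow> 'g \<Rightarrow> 'g) \<times> (nat \<Rightarrow> nat)) monoid" where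
  "diag_group T m =
     wreath_product {1..m} (AutoGroup T) (Bij {1..m})
       \<lparr>carrier := {(a, \<pi>). a \<in> {1..m} \<rightarrow>\<^sub>E carrier (AutoGroup T) \<and> \<pi> \<in> Bij {1..m} \<and>
          (\<forall>i\<in>{1..m}. \<forall>j\<in>{1..m}.
             inner_auts T #>\<^bsub>AutoGroup T\<^esub> a i = inner_auts T #>\<^bsub>AutoGroup T\<^esub> a j)}\<rparr>"

definition diag_point_stabilizer ::
    "('g, 'm) monoid_scheme \<Rightarrow> nat \<Rightarrow> ((nat \<Rightarrow> 'g \<Rightarrow> 'g) \<times> (nat \<Rightarrow> nat)) set" where
  "diag_point_stabilizer T m =
     {(a, \<pi>) \<in> carrier (diag_group T m). \<forall>i\<in>{1..m}. \<forall>j\<in>{1..m}. a i = a j}"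

definition diag_socle ::
    "('g, 'm) monoid_scheme \<Rightarrow> nat \<Rightarrow> ((nat \<Rightarrow> 'g \<Rightarrow> 'g) \<times> (nat \<Rightarrow> nat)) set" where
  "diag_socle T m = ({1..m} \<rightarrow>\<^sub>E inner_auts T) \<times> {\<lambda>i\<in>{1..m}. i}"

definition left_cosets :: "('g, 'm) monoid_scheme \<Rightarrow> 'g set \<Rightarrow> 'g set set" where
  "left_cosets G H = {x <#\<^bsub>G\<^esub> H | x. x \<in> carrier G}"

text \<open>
  A permutation group \<open>L\<close> on \<open>\<Gamma>\<close> is of diagonal type if \<open>\<Gamma>\<close> can be identified with the set of
  cosets of \<open>D\<close> in \<open>W\<close> so that \<open>L\<close> becomes such a group. As \<open>\<Gamma>\<close> then has \<open>|T|\<^sup>m\<^sup>-\<^sup>1 \<ge> |T|\<close>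
  points, taking the elements of \<open>T\<close> from the type of the points is no restriction. The
  condition on the permutation group induced on the \<open>m\<close> factors is exactly primitivity of \<open>L\<close>,
  which is imposed separately.
\<close>

definition diagonal_type :: "'a set \<Rightarrow> ('a \<Rightarrow> 'a) set \<Rightarrow> bool" where
  "diagonal_type \<Gamma> L \<longleftrightarrow>
     (\<exists>T :: 'a monoid. \<exists>m X \<theta>.
        simple_group T \<and> finite (carrier T) \<and> \<not> comm_group T \<and> m \<ge> 2 \<and>
        subgroup X (diag_group T m) \<and> diag_socle T m \<subseteq> X \<and>
        bij_betw \<theta> \<Gamma> (left_cosets (diag_group T m) (diag_point_stabilizer T m)) \<and>
        L = {\<lambda>\<gamma>\<in>\<Gamma>. inv_into \<Gamma> \<theta> (x <#\<^bsub>diag_group T m\<^esub> \<theta> \<gamma>) | x. x \<in> X})"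

definition product_type :: "'a set \<Rightarrow> ('a \<Rightarrow> 'a) set \<Rightarrow> nat \<Rightarrow> (nat \<Rightarrow> nat) set \<Rightarrow> bool" where
  "product_type \<Gamma> L k P \<longleftrightarrow>
     k \<ge> 2 \<and>
     subgroup P (BijGroup {1..k}) \<and>
     transitive_action (perm_group {1..k} P) {1..k} (\<lambda>\<sigma>. \<sigma>) \<and>
     finite \<Gamma> \<and>
     subgroup L (BijGroup \<Gamma>) \<and>
     primitive_action (perm_group \<Gamma> L) \<Gamma> (\<lambda>g. g) \<and>
     (almost_simple (perm_group \<Gamma> L) \<or> diagonal_type \<Gamma> L)"


section \<open>Distinguishing partitions\<close>

definition distinguishing_partition :: "nat \<Rightarrow> (nat \<Rightarrow> nat) set \<Rightarrow> nat set set \<Rightarrow> bool" where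
  "distinguishing_partition k P \<Q> \<longleftrightarrow>
     partition_on {1..k} \<Q> \<and> (\<Inter>A\<in>\<Q>. {\<sigma> \<in> P. \<sigma> ` A = A}) = {\<lambda>i\<in>{1..k}. i}"

definition distinguishing_number :: "nat \<Rightarrow> (nat \<Rightarrow> nat) set \<Rightarrow> nat" where
  "distinguishing_number k P = (LEAST m. \<exists>\<Q>. distinguishing_partition k P \<Q> \<and> card \<Q> = m)"

definition num_distinguishing_partitions :: "nat \<Rightarrow> (nat \<Rightarrow> nat) set \<Rightarrow> nat \<Rightarrow> nat" where
  "num_distinguishing_partitions k P m = card {\<Q>. distinguishing_partition k P \<Q> \<and> card \<Q> = m}"

end

theory Submission
  imports Defs
begin

text \<open>
  Let \<open>H = L\<^sub>\<alpha> \<wr> P\<close> be the stabiliser of the constant point \<open>(\<alpha>, \<dots>, \<alpha>)\<close>. A point \<open>\<omega>\<close> of \<open>\<Gamma>\<^sup>k\<close> has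
  trivial stabiliser in \<open>H\<close> iff every \<open>\<omega>\<^sub>i\<close> lies in a regular orbit of \<open>L\<^sub>\<alpha>\<close> and the partition of
  \<open>{1, \<dots>, k}\<close> that groups together the \<open>i\<close> with \<open>\<omega>\<^sub>i\<close> in the same orbit is distinguishing. A
  distinguishing partition into \<open>m\<close> parts arises from \<open>m! (r(L) choose m)\<close> assignments of regular
  orbits, each realised by \<open>|L\<^sub>\<alpha>|\<^sup>k\<close> points. Dividing the number of points by \<open>|H| = |L\<^sub>\<alpha>|\<^sup>k |P|\<close>
  gives the number of regular orbits of \<open>H\<close>.
\<close>

section \<open>Colourings with prescribed colour classes\<close>

lemma prod_diff_eq_fact_times_binomial:
  fixes n m :: nat
  shows "prod ((-) n) {0..<m} = fact m * (n choose m)"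
proof (induction m)
  case (Suc m)
  \<comment> \<open>Both sides equal \<open>n * ((n - 1) choose m)\<close>. Truncated subtraction is
    harmless, because \<open>n choose m\<close> vanishes for m > n.\<close>
  have "Suc m * (n choose Suc m) = (n - m) * (n choose m)"
    by (cases n)
       (simp_all add: binomial_absorb_comp Suc_times_binomial del: binomial_Suc_Suc mult_Suc)
  moreover have "fact (Suc m) * (n choose Suc m) = fact m * (Suc m * (n choose Suc m))"
    by (simp add: algebra_simps)
  ultimately show ?case using Suc by (simp add: algebra_simps)
qed simp


text \<open>Indexing the fibres by points instead of colours leaves out the colours that do not
  occur, so no fibre is empty and the fibres form a partition.\<close>

definition fibres :: "'i set \<Rightarrow> ('i \<Rightarrow> 'c) \<Rightarrow> 'i set set" where
  "fibres I \<chi> = (\<lambda>j. {i \<in> I. \<chi> i = \<chi> j}) ` I"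

lemma partition_on_fibres: "partition_on I (fibres I \<chi>)"
  by (auto simp: partition_on_def fibres_def disjoint_def)

text \<open>A colouring with fibres \<open>Q\<close> is constant on each block and separates
  distinct blocks. It is therefore the same thing as an injection from \<open>Q\<close> to
  \<open>C\<close>, and injections are counted by a falling factorial.\<close>

lemma card_colourings_with_fibres:
  assumes I: "finite I" and C: "finite C" and Q: "partition_on I Q"
  shows "card {\<chi> \<in> I \<rightarrow>\<^sub>E C. fibres I \<chi> = Q} = fact (card Q) * (card C choose card Q)"
proof -
  have "\<exists>B. B \<in> Q \<and> i \<in> B" if "i \<in> I" for i
    using that partition_onD1[OF Q] by blast
  \<comment> \<open>\<open>p i\<close> is the block containing \<open>i\<close>; below,
    \<open>s B\<close> is a chosen representative of the block \<open>B\<close>.\<close>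
  then obtain p where p: "\<And>i. i \<in> I \<Longrightarrow> p i \<in> Q \<and> i \<in> p i" by metis
  have pB: "p i = B" if "B \<in> Q" "i \<in> B" for i B
  proof -
    have "i \<in> I" using that partition_onD1[OF Q] by blast
    then show ?thesis using p that disjointD[OF partition_onD2[OF Q]] by blast
  qed
  define s where "s B = (SOME i. i \<in> B)" for B :: "'a set"
  have s: "s B \<in> B" if "B \<in> Q" for B
    unfolding s_def using that partition_onD3[OF Q] by (metis ex_in_conv someI_ex)
  have sI: "s B \<in> I" if "B \<in> Q" for B
    using s[OF that] that partition_onD1[OF Q] by blast
  have ps: "p (s B) = B" if "B \<in> Q" for B using pB that s by blast
  \<comment> \<open>Pointwise form of the condition on fibres: two points share a colour exactly
    when they share a block.\<close>
  have fib: "fibres I \<chi> = Q \<longleftrightarrow> (\<forall>i\<in>I. \<forall>j\<in>I. \<chi> i = \<chi> j \<longleftrightarrow> p i = p j)"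
    (is "?l \<longleftrightarrow> ?r") for \<chi> :: "'a \<Rightarrow> 'b"
  proof
    assume l: ?l
    have eq: "p j = {i \<in> I. \<chi> i = \<chi> j}" if "j \<in> I" for j
      using that by (intro pB) (auto simp: l[symmetric] fibres_def)
    show ?r
    proof (intro ballI)
      fix i j assume "i \<in> I" "j \<in> I"
      then show "\<chi> i = \<chi> j \<longleftrightarrow> p i = p j" using p[of i] by (auto simp: eq)
    qed
  next
    assume r: ?r
    have eq: "{i \<in> I. \<chi> i = \<chi> j} = p j" if j: "j \<in> I" for j
    proof -
      have "p j \<subseteq> I" using p[OF j] partition_onD1[OF Q] by blast
      moreover have "i \<in> p j \<longleftrightarrow> p i = p j" if "i \<in> I" for i
        using p[OF that] p[OF j] pB[of "p j" i] by auto
      ultimately show ?thesis using r j by auto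
    qed
    have "fibres I \<chi> = p ` I" unfolding fibres_def by (rule image_cong) (auto simp: eq)
    also have "\<dots> = Q" using p ps sI by (metis image_subset_iff subsetI subset_antisym image_eqI)
    finally show ?l .
  qed
  \<comment> \<open>An injection on blocks is pulled back along \<open>p\<close>; the inverse map
    reads off the colour of each block at its representative.\<close>
  have "bij_betw (\<lambda>\<psi>. \<lambda>i\<in>I. \<psi> (p i)) {\<psi> \<in> Q \<rightarrow>\<^sub>E C. inj_on \<psi> Q} {\<chi> \<in> I \<rightarrow>\<^sub>E C. fibres I \<chi> = Q}"
  proof (rule bij_betw_byWitness[where f' = "\<lambda>\<chi>. \<lambda>B\<in>Q. \<chi> (s B)"])
    show "\<forall>\<psi>\<in>{\<psi> \<in> Q \<rightarrow>\<^sub>E C. inj_on \<psi> Q}. (\<lambda>B\<in>Q. (\<lambda>i\<in>I. \<psi> (p i)) (s B)) = \<psi>"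
      by (auto simp: fun_eq_iff ps sI PiE_iff extensional_def)
    show "\<forall>\<chi>\<in>{\<chi> \<in> I \<rightarrow>\<^sub>E C. fibres I \<chi> = Q}. (\<lambda>i\<in>I. (\<lambda>B\<in>Q. \<chi> (s B)) (p i)) = \<chi>"
    proof clarify
      fix \<chi> assume \<chi>: "\<chi> \<in> I \<rightarrow>\<^sub>E C" and "Q = fibres I \<chi>"
      then have "\<chi> (s (p i)) = \<chi> i" if "i \<in> I" for i
        using fib[of \<chi>] p[OF that] sI ps that by metis
      then show "(\<lambda>i\<in>I. (\<lambda>B\<in>fibres I \<chi>. \<chi> (s B)) (p i)) = \<chi>"
        using \<chi> p \<open>Q = fibres I \<chi>\<close> by (auto simp: fun_eq_iff PiE_iff extensional_def)
    qed
    show "(\<lambda>\<psi>. \<lambda>i\<in>I. \<psi> (p i)) ` {\<psi> \<in> Q \<rightarrow>\<^sub>E C. inj_on \<psi> Q} \<subseteq> {\<chi> \<in> I \<rightarrow>\<^sub>E C. fibres I \<chi> = Q}"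
      using p by (auto simp: fib inj_on_eq_iff)
    show "(\<lambda>\<chi>. \<lambda>B\<in>Q. \<chi> (s B)) ` {\<chi> \<in> I \<rightarrow>\<^sub>E C. fibres I \<chi> = Q} \<subseteq> {\<psi> \<in> Q \<rightarrow>\<^sub>E C. inj_on \<psi> Q}"
      using sI ps by (auto simp: fib inj_on_def PiE_iff)
  qed
  then have "card {\<chi> \<in> I \<rightarrow>\<^sub>E C. fibres I \<chi> = Q} = card {\<psi> \<in> Q \<rightarrow>\<^sub>E C. inj_on \<psi> Q}"
    by (simp add: bij_betw_same_card)
  also have "\<dots> = prod ((-) (card C)) {0..<card Q}"
    using card_inj_on_subset_funcset[OF finite_elements[OF I Q] C subset_refl] by simp
  finally show ?thesis by (simp add: prod_diff_eq_fact_times_binomial)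
qed

section \<open>Regular orbits and points with trivial stabiliser\<close>

text \<open>Stabilisers along an orbit are conjugate: if \<open>h\<close> fixes
  \<open>\<phi> g x\<close>, then the conjugate of \<open>h\<close> by the inverse of
  \<open>g\<close> fixes \<open>x\<close>. Regularity of an orbit can thus be tested at one
  point.\<close>

lemma (in group_action) stabilizer_trivial_on_orbit:
  assumes x: "x \<in> E" and triv: "stabilizer G \<phi> x = {\<one>}" and y: "y \<in> orbit G \<phi> x"
  shows "stabilizer G \<phi> y = {\<one>}"
proof -
  interpret G: group G using group_hom group_hom.axioms(1) by auto
  obtain g where g: "g \<in> carrier G" and y: "y = \<phi> g x" using y by (auto simp: orbit_def)
  have yE: "y \<in> E" using element_image[OF g x] y by simp
  have "h = \<one>" if "h \<in> stabilizer G \<phi> y" for h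
  proof -
    have h: "h \<in> carrier G" "\<phi> h y = y" using that by (auto simp: stabilizer_def)
    have "\<phi> (inv g \<otimes> (h \<otimes> g)) x = x"
      using g h x yE orbit_sym_aux[OF g x y[symmetric]] by (simp add: composition_rule flip: y)
    then have "inv g \<otimes> (h \<otimes> g) \<in> stabilizer G \<phi> x" using g h by (simp add: stabilizer_def)
    then have "inv g \<otimes> (h \<otimes> g) = \<one>" using triv by simp
    then have "h \<otimes> g = g" using g h by (metis G.inv_solve_left G.m_closed G.r_one G.one_closed)
    then show ?thesis using g h by simp
  qed
  then show ?thesis using stabilizer_one_closed[OF yE] by blast
qed

lemma (in group_action) Union_regular_orbits:
  "\<Union> (regular_orbits G E \<phi>) = {x \<in> E. stabilizer G \<phi> x = {\<one>}}"
proof -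
  have "x \<in> \<Union> (regular_orbits G E \<phi>)" if "x \<in> E" "stabilizer G \<phi> x = {\<one>}" for x
    using that orbit_refl stabilizer_trivial_on_orbit by (auto simp: regular_orbits_def orbits_def)
  then show ?thesis using orbits_coverture by (auto simp: regular_orbits_def)
qed

lemma (in group_action) card_regular_orbit:
  assumes "\<Delta> \<in> regular_orbits G E \<phi>"
  shows "card \<Delta> = order G"
proof -
  obtain x where "x \<in> E" "\<Delta> = orbit G \<phi> x" using assms by (auto simp: regular_orbits_def orbits_def)
  then show ?thesis
    using orbit_stabilizer_theorem[of x] orbit_refl[of x] assms by (simp add: regular_orbits_def)
qed

lemma (in group_action) disjoint_regular_orbits: "disjoint (regular_orbits G E \<phi>)"
  using disjoint_union by (auto simp: disjoint_def regular_orbits_def)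

text \<open>Regular orbits are pairwise disjoint, have as many points as the group has elements, and
  together cover exactly the points with trivial stabiliser. Counting orbits is thereby reduced to
  counting points.\<close>

lemma (in group_action) card_regular_orbits:
  assumes "finite E"
  shows "card (regular_orbits G E \<phi>) * order G = card {x \<in> E. stabilizer G \<phi> x = {\<one>}}"
proof -
  have "finite \<Delta>" if "\<Delta> \<in> regular_orbits G E \<phi>" for \<Delta>
    using that assms Union_regular_orbits
    by (metis (no_types, lifting) Union_upper finite_subset mem_Collect_eq subsetI)
  then have "card (\<Union> (regular_orbits G E \<phi>)) = sum card (regular_orbits G E \<phi>)"
    using disjoint_regular_orbits
    by (intro card_Union_disjoint) (auto simp: disjoint_def pairwise_def disjnt_def)
  then show ?thesis by (simp add: Union_regular_orbits card_regular_orbit)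
qed

text \<open>Every block contributes at least one point. This yields the upper limit k of the
  sum.\<close>

lemma card_partition_on_le:
  assumes A: "finite A" and Q: "partition_on A Q"
  shows "card Q \<le> card A"
proof -
  have "card Q = (\<Sum>B\<in>Q. 1)" by simp
  also have "\<dots> \<le> (\<Sum>B\<in>Q. card B)"
  proof (rule sum_mono)
    fix B assume "B \<in> Q"
    then have "B \<noteq> {}" "finite B"
      using partition_onD3[OF Q] partition_onD1[OF Q] A by (auto intro: finite_subset)
    then show "1 \<le> card B" by (simp add: Suc_le_eq card_gt_0_iff)
  qed
  also have "\<dots> = card A" using product_partition[OF Q] A partition_onD1[OF Q]
    by (metis Union_upper finite_subset)
  finally show ?thesis .
qed

lemma group_action_perm_group:
  assumes "subgroup L (BijGroup E)"
  shows "group_action (perm_group E L) E (\<lambda>g. g)"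
proof -
  have "group_action (BijGroup E) E (\<lambda>g. g)"
    by (intro group_action.intro group_hom.intro group_hom_axioms.intro group_BijGroup)
       (auto simp: hom_def)
  then show ?thesis unfolding perm_group_def using assms by (rule group_action.induced_action)
qed

section \<open>The stabiliser of a constant point in the wreath product\<close>

locale product_action_base =
  fixes \<Gamma> :: "'a set" and L :: "('a \<Rightarrow> 'a) set" and k :: nat and P :: "(nat \<Rightarrow> nat) set" and \<alpha> :: 'a
  assumes finite_\<Gamma>: "finite \<Gamma>" and L: "subgroup L (BijGroup \<Gamma>)"
    and k: "0 < k" and P: "subgroup P (BijGroup {1..k})" and \<alpha>: "\<alpha> \<in> \<Gamma>"
begin

definition L\<^sub>\<alpha> :: "('a \<Rightarrow> 'a) set" where
  "L\<^sub>\<alpha> = stabilizer (perm_group \<Gamma> L) (\<lambda>g. g) \<alpha>"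

text \<open>The point stabiliser as a group; its regular orbits on \<Gamma> are the regular
  suborbits of \<open>L\<close> at \<alpha>.\<close>

definition X :: "('a \<Rightarrow> 'a) monoid" where
  "X = perm_group \<Gamma> L \<lparr>carrier := L\<^sub>\<alpha>\<rparr>"

abbreviation W :: "((nat \<Rightarrow> 'a \<Rightarrow> 'a) \<times> (nat \<Rightarrow> nat)) monoid" where
  "W \<equiv> wreath_product {1..k} (perm_group \<Gamma> L) P"

definition H :: "((nat \<Rightarrow> 'a \<Rightarrow> 'a) \<times> (nat \<Rightarrow> nat)) set" where
  "H = stabilizer W (product_action {1..k} \<Gamma>) (\<lambda>i\<in>{1..k}. \<alpha>)"

text \<open>The counterpart of \<open>X\<close> for the product action, with the constant point as
  base point.\<close>

definition Y :: "((nat \<Rightarrow> 'a \<Rightarrow> 'a) \<times> (nat \<Rightarrow> nat)) monoid" where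
  "Y = W \<lparr>carrier := H\<rparr>"

sublocale LA: group_action "perm_group \<Gamma> L" \<Gamma> "\<lambda>g. g"
  by (rule group_action_perm_group[OF L])

sublocale WA: group_action W "{1..k} \<rightarrow>\<^sub>E \<Gamma>" "product_action {1..k} \<Gamma>"
  by (rule group_action_product_action[OF L P])

sublocale X: group_action X \<Gamma> "\<lambda>g. g"
  unfolding X_def L\<^sub>\<alpha>_def by (rule LA.induced_action[OF LA.stabilizer_subgroup[OF \<alpha>]])

lemma \<alpha>_const: "(\<lambda>i\<in>{1..k}. \<alpha>) \<in> {1..k} \<rightarrow>\<^sub>E \<Gamma>"
  using \<alpha> by simp

sublocale Y: group_action Y "{1..k} \<rightarrow>\<^sub>E \<Gamma>" "product_action {1..k} \<Gamma>"
  unfolding Y_def H_def by (rule WA.induced_action[OF WA.stabilizer_subgroup[OF \<alpha>_const]])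

lemma carrier_X [simp]: "carrier X = L\<^sub>\<alpha>"
  and carrier_Y [simp]: "carrier Y = H"
  and one_X [simp]: "\<one>\<^bsub>X\<^esub> = (\<lambda>x\<in>\<Gamma>. x)"
  and one_Y [simp]: "\<one>\<^bsub>Y\<^esub> = (\<lambda>i\<in>{1..k}. \<lambda>x\<in>\<Gamma>. x, \<lambda>i\<in>{1..k}. i)"
  by (simp_all add: X_def Y_def perm_group_def BijGroup_def wreath_product_def)

lemma id_mem: "(\<lambda>x\<in>\<Gamma>. x) \<in> L\<^sub>\<alpha>" "(\<lambda>i\<in>{1..k}. i) \<in> P"
  using LA.stabilizer_one_closed[OF \<alpha>] subgroup.one_closed[OF P]
  by (simp_all add: L\<^sub>\<alpha>_def perm_group_def BijGroup_def)

lemma P_bij: "\<sigma> \<in> P \<Longrightarrow> bij_betw \<sigma> {1..k} {1..k}"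
  and P_ext: "\<sigma> \<in> P \<Longrightarrow> \<sigma> \<in> extensional {1..k}"
  using subgroup.subset[OF P] by (auto simp: BijGroup_def Bij_def)

lemma P_mem: "\<sigma> \<in> P \<Longrightarrow> i \<in> {1..k} \<Longrightarrow> \<sigma> i \<in> {1..k}"
  using P_bij by (rule bij_betwE[rule_format])

lemma finite_L\<^sub>\<alpha>: "finite L\<^sub>\<alpha>"
proof (rule finite_subset)
  have "L \<subseteq> Bij \<Gamma>" using subgroup.subset[OF L] by (simp add: BijGroup_def)
  then have "L \<subseteq> \<Gamma> \<rightarrow>\<^sub>E \<Gamma>" by (auto simp: PiE_iff Bij_def bij_betw_def subset_iff)
  then show "L\<^sub>\<alpha> \<subseteq> \<Gamma> \<rightarrow>\<^sub>E \<Gamma>" by (auto simp: L\<^sub>\<alpha>_def stabilizer_def perm_group_def)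
  show "finite (\<Gamma> \<rightarrow>\<^sub>E \<Gamma>)" by (intro finite_PiE finite_\<Gamma>)
qed

lemma finite_P: "finite P"
proof (rule finite_subset)
  show "P \<subseteq> {1..k} \<rightarrow>\<^sub>E {1..k}" by (intro subsetI PiE_I) (rule P_mem extensional_arb[OF P_ext]; assumption)+
  show "finite ({1..k} \<rightarrow>\<^sub>E {1..k})" by (intro finite_PiE) auto
qed

lemma card_L\<^sub>\<alpha>_pos: "card L\<^sub>\<alpha> > 0"
  using finite_L\<^sub>\<alpha> id_mem by (auto simp: card_gt_0_iff)

lemma card_P_pos: "card P > 0"
  using finite_P id_mem by (auto simp: card_gt_0_iff)

text \<open>Substituting \<open>\<sigma> i\<close> for \<open>i\<close> removes the inverse
  permutation that the product action contains.\<close>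

lemma product_action_eq_iff:
  assumes \<sigma>: "\<sigma> \<in> P" and \<omega>: "\<omega> \<in> {1..k} \<rightarrow>\<^sub>E \<Gamma>"
  shows "product_action {1..k} \<Gamma> (f, \<sigma>) \<omega> = \<omega> \<longleftrightarrow> (\<forall>i\<in>{1..k}. f (\<sigma> i) (\<omega> i) = \<omega> (\<sigma> i))"
proof -
  have "product_action {1..k} \<Gamma> (f, \<sigma>) \<omega> = \<omega> \<longleftrightarrow>
      (\<forall>i\<in>{1..k}. f i (\<omega> (inv_into {1..k} \<sigma> i)) = \<omega> i)"
    using \<omega> by (auto simp: product_action_def fun_eq_iff PiE_iff extensional_def)
  also have "\<dots> \<longleftrightarrow> (\<forall>i\<in>\<sigma> ` {1..k}. f i (\<omega> (inv_into {1..k} \<sigma> i)) = \<omega> i)"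
    using P_bij[OF \<sigma>] by (simp add: bij_betw_def)
  also have "\<dots> \<longleftrightarrow> (\<forall>i\<in>{1..k}. f (\<sigma> i) (\<omega> i) = \<omega> (\<sigma> i))"
    using bij_betw_inv_into_left[OF P_bij[OF \<sigma>]] by simp
  finally show ?thesis .
qed

text \<open>The constant point is fixed exactly when every \<open>f (\<sigma> i)\<close> fixes
  \<alpha>. As \<sigma> permutes the indices, this restricts only the base part, and the stabiliser
  is the full wreath product of \<open>L\<^sub>\<alpha>\<close> by \<open>P\<close>.\<close>

lemma H_eq: "H = ({1..k} \<rightarrow>\<^sub>E L\<^sub>\<alpha>) \<times> P"
proof -
  have "(f, \<sigma>) \<in> H \<longleftrightarrow> f \<in> {1..k} \<rightarrow>\<^sub>E L\<^sub>\<alpha> \<and> \<sigma> \<in> P" for f \<sigma>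
  proof (cases "\<sigma> \<in> P")
    case True
    have "(\<forall>i\<in>{1..k}. f (\<sigma> i) \<alpha> = \<alpha>) \<longleftrightarrow> (\<forall>i\<in>\<sigma> ` {1..k}. f i \<alpha> = \<alpha>)" by simp
    also have "\<dots> \<longleftrightarrow> (\<forall>i\<in>{1..k}. f i \<alpha> = \<alpha>)" using P_bij[OF True] by (simp add: bij_betw_def)
    finally have "product_action {1..k} \<Gamma> (f, \<sigma>) (\<lambda>i\<in>{1..k}. \<alpha>) = (\<lambda>i\<in>{1..k}. \<alpha>)
        \<longleftrightarrow> (\<forall>i\<in>{1..k}. f i \<alpha> = \<alpha>)"
      using product_action_eq_iff[OF True \<alpha>_const, of f] P_mem[OF True] by simp
    then show ?thesis
      using True by (auto simp: H_def L\<^sub>\<alpha>_def stabilizer_def wreath_product_def PiE_iff)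
  qed (simp add: H_def stabilizer_def wreath_product_def)
  then show ?thesis by auto
qed

lemma card_H: "card H = card L\<^sub>\<alpha> ^ k * card P"
  by (simp add: H_eq card_cartesian_product card_funcsetE)

section \<open>Regular points and distinguishing partitions\<close>

lemma stabilizer_Y_trivial_iff:
  assumes \<omega>: "\<omega> \<in> {1..k} \<rightarrow>\<^sub>E \<Gamma>"
  shows "stabilizer Y (product_action {1..k} \<Gamma>) \<omega> = {\<one>\<^bsub>Y\<^esub>} \<longleftrightarrow>
    (\<forall>f\<in>{1..k} \<rightarrow>\<^sub>E L\<^sub>\<alpha>. \<forall>\<sigma>\<in>P. (\<forall>i\<in>{1..k}. f (\<sigma> i) (\<omega> i) = \<omega> (\<sigma> i)) \<longrightarrow>
      f = (\<lambda>i\<in>{1..k}. \<lambda>x\<in>\<Gamma>. x) \<and> \<sigma> = (\<lambda>i\<in>{1..k}. i))" (is "_ \<longleftrightarrow> ?r")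
proof -
  have "stabilizer Y (product_action {1..k} \<Gamma>) \<omega> = {\<one>\<^bsub>Y\<^esub>} \<longleftrightarrow>
      stabilizer Y (product_action {1..k} \<Gamma>) \<omega> \<subseteq> {\<one>\<^bsub>Y\<^esub>}"
    using Y.stabilizer_one_closed[OF \<omega>] by blast
  also have "\<dots> \<longleftrightarrow> (\<forall>f\<in>{1..k} \<rightarrow>\<^sub>E L\<^sub>\<alpha>. \<forall>\<sigma>\<in>P. product_action {1..k} \<Gamma> (f, \<sigma>) \<omega> = \<omega> \<longrightarrow>
      f = (\<lambda>i\<in>{1..k}. \<lambda>x\<in>\<Gamma>. x) \<and> \<sigma> = (\<lambda>i\<in>{1..k}. i))"
    unfolding stabilizer_def carrier_Y H_eq one_Y by blast
  also have "\<dots> \<longleftrightarrow> ?r" using product_action_eq_iff[OF _ \<omega>] by meson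
  finally show ?thesis .
qed

text \<open>Orbits that meet coincide, so equality can be decided on any two
  representatives.\<close>

lemma orbits_X_eq_iff:
  assumes "A \<in> orbits X \<Gamma> (\<lambda>g. g)" "B \<in> orbits X \<Gamma> (\<lambda>g. g)" "x \<in> A" "y \<in> B"
  shows "A = B \<longleftrightarrow> (\<exists>a\<in>L\<^sub>\<alpha>. a x = y)"
proof -
  have \<Gamma>: "x \<in> \<Gamma>" "y \<in> \<Gamma>" using assms X.orbits_coverture by blast+
  have "A = orbit X (\<lambda>g. g) x" "B = orbit X (\<lambda>g. g) y"
    using assms \<Gamma> X.orbit_refl X.disjoint_union unfolding orbits_def by blast+
  moreover have "orbit X (\<lambda>g. g) x = orbit X (\<lambda>g. g) y \<longleftrightarrow> y \<in> orbit X (\<lambda>g. g) x"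
    using \<Gamma> X.orbit_refl X.disjoint_union unfolding orbits_def by blast
  ultimately show ?thesis by (auto simp: orbit_def)
qed

text \<open>A permutation stabilises every colour class setwise exactly when it preserves the colour
  of every point.\<close>

lemma distinguishing_fibres_iff:
  "distinguishing_partition k P (fibres {1..k} \<chi>) \<longleftrightarrow>
    (\<forall>\<sigma>\<in>P. (\<forall>i\<in>{1..k}. \<chi> (\<sigma> i) = \<chi> i) \<longrightarrow> \<sigma> = (\<lambda>i\<in>{1..k}. i))"
proof -
  have *: "(\<forall>A\<in>fibres {1..k} \<chi>. \<sigma> ` A = A) \<longleftrightarrow> (\<forall>i\<in>{1..k}. \<chi> (\<sigma> i) = \<chi> i)" (is "?l \<longleftrightarrow> ?r")
    if \<sigma>: "\<sigma> \<in> P" for \<sigma>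
  proof
    assume l: ?l
    show ?r
    proof
      fix i assume i: "i \<in> {1..k}"
      then have "\<sigma> ` {j \<in> {1..k}. \<chi> j = \<chi> i} = {j \<in> {1..k}. \<chi> j = \<chi> i}"
        using l by (simp add: fibres_def)
      then show "\<chi> (\<sigma> i) = \<chi> i" using i by blast
    qed
  next
    assume r: ?r
    show ?l
    proof
      fix A assume "A \<in> fibres {1..k} \<chi>"
      then obtain j where A: "A = {i \<in> {1..k}. \<chi> i = \<chi> j}" by (auto simp: fibres_def)
      have "inj_on \<sigma> A" using P_bij[OF \<sigma>] by (auto simp: A bij_betw_def intro: inj_on_subset)
      moreover have "\<sigma> ` A \<subseteq> A" using r P_mem[OF \<sigma>] by (auto simp: A)
      \<comment> \<open>An injective map of a finite set into itself is onto, so the inclusion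
        suffices.\<close>
      ultimately show "\<sigma> ` A = A" by (intro endo_inj_surj) (auto simp: A)
    qed
  qed
  \<comment> \<open>Over an empty family the intersection would be the whole type and not
    \<open>P\<close>; k > 0 excludes this.\<close>
  have "fibres {1..k} \<chi> \<noteq> {}" using k by (auto simp: fibres_def)
  then have "(\<Inter>A\<in>fibres {1..k} \<chi>. {\<sigma> \<in> P. \<sigma> ` A = A}) = {\<sigma> \<in> P. \<forall>A\<in>fibres {1..k} \<chi>. \<sigma> ` A = A}"
    by blast
  also have "\<dots> = {\<sigma> \<in> P. \<forall>i\<in>{1..k}. \<chi> (\<sigma> i) = \<chi> i}" using * by blast
  finally have eq: "(\<Inter>A\<in>fibres {1..k} \<chi>. {\<sigma> \<in> P. \<sigma> ` A = A}) = \<dots>" .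
  have "(\<lambda>i\<in>{1..k}. i) \<in> {\<sigma> \<in> P. \<forall>i\<in>{1..k}. \<chi> (\<sigma> i) = \<chi> i}" using id_mem by simp
  then show ?thesis unfolding distinguishing_partition_def eq using partition_on_fibres by blast
qed

text \<open>\<open>\<chi> i\<close> is the orbit of \<open>\<omega> i\<close>. If
  \<open>(f, \<sigma>)\<close> fixes \<omega>, then \<sigma> preserves \<chi>; conversely every such
  \<sigma> lifts to an element fixing \<omega>. The stabiliser is trivial when both its permutation
  part and its base part are.\<close>

lemma regular_point_iff:
  assumes \<chi>: "\<chi> \<in> {1..k} \<rightarrow> orbits X \<Gamma> (\<lambda>g. g)" and \<omega>: "\<omega> \<in> Pi\<^sub>E {1..k} \<chi>"
  shows "stabilizer Y (product_action {1..k} \<Gamma>) \<omega> = {\<one>\<^bsub>Y\<^esub>} \<longleftrightarrow>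
    (\<forall>i\<in>{1..k}. stabilizer X (\<lambda>g. g) (\<omega> i) = {\<one>\<^bsub>X\<^esub>}) \<and>
    distinguishing_partition k P (fibres {1..k} \<chi>)" (is "?l \<longleftrightarrow> ?r")
proof -
  have \<omega>i: "\<omega> i \<in> \<Gamma>" if "i \<in> {1..k}" for i
    using that \<chi> \<omega> X.orbits_coverture by blast
  have \<omega>\<Gamma>: "\<omega> \<in> {1..k} \<rightarrow>\<^sub>E \<Gamma>" using \<omega> \<omega>i by (simp add: PiE_iff)
  have orb: "\<chi> i = \<chi> j \<longleftrightarrow> (\<exists>a\<in>L\<^sub>\<alpha>. a (\<omega> i) = \<omega> j)" if "i \<in> {1..k}" "j \<in> {1..k}" for i j
    by (rule orbits_X_eq_iff) (use that \<chi> \<omega> in auto)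
  note triv = stabilizer_Y_trivial_iff[OF \<omega>\<Gamma>]
  show ?thesis
  proof
    assume l: ?l
    show ?r
    proof (intro conjI ballI)
      fix i assume i: "i \<in> {1..k}"
      have "a = (\<lambda>x\<in>\<Gamma>. x)" if a: "a \<in> L\<^sub>\<alpha>" "a (\<omega> i) = \<omega> i" for a
      proof -
        \<comment> \<open>The base element acting as \<open>a\<close> in coordinate \<open>i\<close>
          and trivially elsewhere fixes \<omega>.\<close>
        let ?f = "\<lambda>j\<in>{1..k}. if j = i then a else (\<lambda>x\<in>\<Gamma>. x)"
        have "?f = (\<lambda>j\<in>{1..k}. \<lambda>x\<in>\<Gamma>. x)"
          using l[unfolded triv, rule_format, of ?f "\<lambda>i\<in>{1..k}. i"] a id_mem \<omega>i by auto
        then show ?thesis using i by (auto dest: fun_cong[of _ _ i])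
      qed
      then show "stabilizer X (\<lambda>g. g) (\<omega> i) = {\<one>\<^bsub>X\<^esub>}"
        using X.stabilizer_one_closed[OF \<omega>i[OF i]]
        unfolding stabilizer_def carrier_X one_X by blast
    next
      have "\<sigma> = (\<lambda>i\<in>{1..k}. i)" if \<sigma>: "\<sigma> \<in> P" and fx: "\<forall>i\<in>{1..k}. \<chi> (\<sigma> i) = \<chi> i" for \<sigma>
      proof -
        have "\<forall>i\<in>{1..k}. \<exists>a\<in>L\<^sub>\<alpha>. a (\<omega> i) = \<omega> (\<sigma> i)"
          using fx P_mem[OF \<sigma>] orb by metis
        then obtain a where a: "\<And>i. i \<in> {1..k} \<Longrightarrow> a i \<in> L\<^sub>\<alpha> \<and> a i (\<omega> i) = \<omega> (\<sigma> i)"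
          by metis
        \<comment> \<open>The lift of \<sigma>: its component at \<open>\<sigma> i\<close> has to be
          \<open>a i\<close>, hence the inverse permutation in the index.\<close>
        let ?f = "\<lambda>j\<in>{1..k}. a (inv_into {1..k} \<sigma> j)"
        have "?f \<in> {1..k} \<rightarrow>\<^sub>E L\<^sub>\<alpha>"
          using a bij_betwE[OF bij_betw_inv_into[OF P_bij[OF \<sigma>]]] by simp
        moreover have "\<forall>i\<in>{1..k}. ?f (\<sigma> i) (\<omega> i) = \<omega> (\<sigma> i)"
          using a P_bij[OF \<sigma>] P_mem[OF \<sigma>] by (simp add: bij_betw_def)
        ultimately show ?thesis using l[unfolded triv] \<sigma> by blast
      qed
      then show "distinguishing_partition k P (fibres {1..k} \<chi>)"
        unfolding distinguishing_fibres_iff by blast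
    qed
  next
    assume r: ?r
    show ?l unfolding triv
    proof (intro ballI impI)
      fix f \<sigma> assume f: "f \<in> {1..k} \<rightarrow>\<^sub>E L\<^sub>\<alpha>" and \<sigma>: "\<sigma> \<in> P"
        and fx: "\<forall>i\<in>{1..k}. f (\<sigma> i) (\<omega> i) = \<omega> (\<sigma> i)"
      have "\<chi> (\<sigma> i) = \<chi> i" if i: "i \<in> {1..k}" for i
      proof -
        have "f (\<sigma> i) \<in> L\<^sub>\<alpha>" using f P_mem[OF \<sigma> i] by blast
        then show ?thesis using orb[OF i P_mem[OF \<sigma> i]] fx i by metis
      qed
      then have \<sigma>id: "\<sigma> = (\<lambda>i\<in>{1..k}. i)" using r \<sigma> unfolding distinguishing_fibres_iff by blast
      have "f i = (\<lambda>x\<in>\<Gamma>. x)" if i: "i \<in> {1..k}" for i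
      proof -
        have "f i \<in> stabilizer X (\<lambda>g. g) (\<omega> i)"
          using fx[rule_format, OF i] i PiE_mem[OF f i] by (simp add: stabilizer_def \<sigma>id)
        then show ?thesis using r i by auto
      qed
      then have "f = (\<lambda>i\<in>{1..k}. \<lambda>x\<in>\<Gamma>. x)" using f
        by (intro PiE_ext[of _ "{1..k}" "\<lambda>_. L\<^sub>\<alpha>"]) (auto simp: id_mem)
      with \<sigma>id show "f = (\<lambda>i\<in>{1..k}. \<lambda>x\<in>\<Gamma>. x) \<and> \<sigma> = (\<lambda>i\<in>{1..k}. i)" by simp
    qed
  qed
qed

section \<open>Counting the regular points\<close>

text \<open>These index the boxes \<open>Pi\<^sub>E {1..k} \<chi>\<close> into which the regular
  points decompose. Extensionality makes a colouring determined by its values on the k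
  coordinates.\<close>

definition colourings :: "(nat \<Rightarrow> 'a set) set" where
  "colourings = {\<chi> \<in> {1..k} \<rightarrow>\<^sub>E regular_orbits X \<Gamma> (\<lambda>g. g).
     distinguishing_partition k P (fibres {1..k} \<chi>)}"

lemma regular_points_eq:
  "{\<omega> \<in> {1..k} \<rightarrow>\<^sub>E \<Gamma>. stabilizer Y (product_action {1..k} \<Gamma>) \<omega> = {\<one>\<^bsub>Y\<^esub>}} =
    (\<Union>\<chi>\<in>colourings. Pi\<^sub>E {1..k} \<chi>)" (is "?S = ?U")
proof
  show "?S \<subseteq> ?U"
  proof clarify
    fix \<omega> assume \<omega>: "\<omega> \<in> {1..k} \<rightarrow>\<^sub>E \<Gamma>"
      and triv: "stabilizer Y (product_action {1..k} \<Gamma>) \<omega> = {\<one>\<^bsub>Y\<^esub>}"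
    \<comment> \<open>The colouring is forced: each coordinate gets the orbit of its entry.\<close>
    let ?\<chi> = "\<lambda>i\<in>{1..k}. orbit X (\<lambda>g. g) (\<omega> i)"
    have \<omega>\<chi>: "\<omega> \<in> Pi\<^sub>E {1..k} ?\<chi>"
      using \<omega> X.orbit_refl by (auto simp: PiE_iff)
    have \<chi>: "?\<chi> \<in> {1..k} \<rightarrow> orbits X \<Gamma> (\<lambda>g. g)" using \<omega> by (auto simp: orbits_def)
    have reg: "\<forall>i\<in>{1..k}. stabilizer X (\<lambda>g. g) (\<omega> i) = {\<one>\<^bsub>X\<^esub>}"
      and dist: "distinguishing_partition k P (fibres {1..k} ?\<chi>)"
      using triv[unfolded regular_point_iff[OF \<chi> \<omega>\<chi>]] by blast+
    have "orbit X (\<lambda>g. g) (\<omega> i) \<in> regular_orbits X \<Gamma> (\<lambda>g. g)" if i: "i \<in> {1..k}" for i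
    proof -
      have "\<omega> i \<in> \<Gamma>" using \<omega> i by blast
      then show ?thesis
        using X.stabilizer_trivial_on_orbit reg i unfolding regular_orbits_def orbits_def by blast
    qed
    then have "?\<chi> \<in> colourings" using dist by (simp add: colourings_def)
    then show "\<omega> \<in> ?U" using \<omega>\<chi> by blast
  qed
  show "?U \<subseteq> ?S"
  proof clarify
    fix \<chi> \<omega> assume \<chi>: "\<chi> \<in> colourings" and \<omega>: "\<omega> \<in> Pi\<^sub>E {1..k} \<chi>"
    have \<chi>r: "\<chi> i \<in> regular_orbits X \<Gamma> (\<lambda>g. g)" if "i \<in> {1..k}" for i
      using \<chi> that by (auto simp: colourings_def)
    have \<omega>r: "\<omega> i \<in> \<Gamma> \<and> stabilizer X (\<lambda>g. g) (\<omega> i) = {\<one>\<^bsub>X\<^esub>}" if "i \<in> {1..k}" for i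
      using \<chi>r[OF that] \<omega> that X.Union_regular_orbits by blast
    have "\<chi> \<in> {1..k} \<rightarrow> orbits X \<Gamma> (\<lambda>g. g)" using \<chi>r by (auto simp: regular_orbits_def)
    then have "stabilizer Y (product_action {1..k} \<Gamma>) \<omega> = {\<one>\<^bsub>Y\<^esub>}"
      using \<chi> \<omega>r by (subst regular_point_iff[OF _ \<omega>]) (auto simp: colourings_def)
    moreover have "\<omega> \<in> {1..k} \<rightarrow>\<^sub>E \<Gamma>" using \<omega> \<omega>r by (simp add: PiE_iff)
    ultimately show "\<omega> \<in> {1..k} \<rightarrow>\<^sub>E \<Gamma> \<and> stabilizer Y (product_action {1..k} \<Gamma>) \<omega> = {\<one>\<^bsub>Y\<^esub>}"
      by blast
  qed
qed

lemma finite_regular_orbits_X: "finite (regular_orbits X \<Gamma> (\<lambda>g. g))"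
proof (rule finite_subset)
  show "regular_orbits X \<Gamma> (\<lambda>g. g) \<subseteq> Pow \<Gamma>" using X.Union_regular_orbits by blast
qed (simp add: finite_\<Gamma>)

text \<open>Distinct colourings differ at some coordinate, where they prescribe disjoint orbits, so
  their boxes are disjoint. Each box is a product of k regular orbits of size
  \<open>card L\<^sub>\<alpha>\<close>.\<close>

lemma card_regular_points:
  "card (\<Union>\<chi>\<in>colourings. Pi\<^sub>E {1..k} \<chi>) = card colourings * card L\<^sub>\<alpha> ^ k"
proof -
  have reg: "\<chi> i \<in> regular_orbits X \<Gamma> (\<lambda>g. g)" if "\<chi> \<in> colourings" "i \<in> {1..k}" for \<chi> i
    using that by (auto simp: colourings_def)
  have fin: "finite colourings"
    unfolding colourings_def
    by (rule finite_subset[OF _ finite_PiE[of "{1..k}" "\<lambda>_. regular_orbits X \<Gamma> (\<lambda>g. g)"]]) (auto simp: finite_regular_orbits_X)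
  have card: "card (\<chi> i) = card L\<^sub>\<alpha>" if "\<chi> \<in> colourings" "i \<in> {1..k}" for \<chi> i
    using X.card_regular_orbit[OF reg[OF that]] by (simp add: order_def)
  have "finite (Pi\<^sub>E {1..k} \<chi>)" if "\<chi> \<in> colourings" for \<chi>
    \<comment> \<open>A set of positive \<open>card\<close> is finite.\<close>
    using card[OF that] card_L\<^sub>\<alpha>_pos by (intro finite_PiE) (auto intro: card_ge_0_finite)
  moreover have "Pi\<^sub>E {1..k} \<chi> \<inter> Pi\<^sub>E {1..k} \<chi>' = {}"
    if \<chi>: "\<chi> \<in> colourings" "\<chi>' \<in> colourings" "\<chi> \<noteq> \<chi>'" for \<chi> \<chi>'
  proof -
    have "\<chi> \<in> {1..k} \<rightarrow>\<^sub>E regular_orbits X \<Gamma> (\<lambda>g. g)" "\<chi>' \<in> {1..k} \<rightarrow>\<^sub>E regular_orbits X \<Gamma> (\<lambda>g. g)"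
      using \<chi>(1,2) by (simp_all add: colourings_def)
    then obtain i where i: "i \<in> {1..k}" "\<chi> i \<noteq> \<chi>' i"
      using \<chi>(3) by (meson PiE_ext)
    then have "\<chi> i \<inter> \<chi>' i = {}"
      using disjointD[OF X.disjoint_regular_orbits reg[OF \<chi>(1) i(1)] reg[OF \<chi>(2) i(1)]] by blast
    then show ?thesis using i(1) by blast
  qed
  ultimately have "card (\<Union>\<chi>\<in>colourings. Pi\<^sub>E {1..k} \<chi>) = (\<Sum>\<chi>\<in>colourings. card (Pi\<^sub>E {1..k} \<chi>))"
    using fin by (intro card_UN_disjoint) auto
  then show ?thesis by (simp add: card_PiE card)
qed

text \<open>Colourings are sorted by their partition into fibres, and the partitions then by their
  number of parts.\<close>

lemma card_colourings:
  "card colourings = (\<Sum>m = distinguishing_number k P..k.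
     fact m * (card (regular_orbits X \<Gamma> (\<lambda>g. g)) choose m) * num_distinguishing_partitions k P m)"
proof -
  let ?R = "regular_orbits X \<Gamma> (\<lambda>g. g)" and ?D = "Collect (distinguishing_partition k P)"
  let ?F = "\<lambda>Q. {\<chi> \<in> {1..k} \<rightarrow>\<^sub>E ?R. fibres {1..k} \<chi> = Q}"
  have part: "partition_on {1..k} Q" if "Q \<in> ?D" for Q
    using that by (simp add: distinguishing_partition_def)
  have finD: "finite ?D"
    by (rule finite_subset[OF _ finitely_many_partition_on[of "{1..k}"]]) (use part in auto)
  have finF: "finite (?F Q)" for Q
    by (rule finite_subset[OF _ finite_PiE[of "{1..k}" "\<lambda>_. regular_orbits X \<Gamma> (\<lambda>g. g)"]]) (auto simp: finite_regular_orbits_X)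
  \<comment> \<open>The lower bound is the minimality of the distinguishing number, the upper one
    holds because blocks are non-empty. Hence the sum over m misses no partition.\<close>
  have range: "card Q \<in> {distinguishing_number k P..k}" if "Q \<in> ?D" for Q
    using that card_partition_on_le[OF _ part[OF that]]
    by (auto simp: distinguishing_number_def intro: Least_le)
  have "colourings = (\<Union>Q\<in>?D. ?F Q)" by (auto simp: colourings_def)
  also have "card \<dots> = (\<Sum>Q\<in>?D. card (?F Q))"
    using finD finF by (intro card_UN_disjoint) auto
  also have "\<dots> = (\<Sum>Q\<in>?D. fact (card Q) * (card ?R choose card Q))"
    by (intro sum.cong refl card_colourings_with_fibres finite_regular_orbits_X part) auto
  also have "\<dots> = (\<Sum>m = distinguishing_number k P..k.
      \<Sum>Q\<in>{Q. Q \<in> ?D \<and> card Q = m}. fact (card Q) * (card ?R choose card Q))"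
    by (rule sum.group[symmetric, OF finD]) (use range in auto)
  also have "\<dots> = (\<Sum>m = distinguishing_number k P..k.
      fact m * (card ?R choose m) * num_distinguishing_partitions k P m)"
    by (intro sum.cong refl) (simp add: num_distinguishing_partitions_def)
  finally show ?thesis .
qed

text \<open>The regular points are counted twice, by orbits of \<open>H\<close> and by colourings,
  and the common factor \<open>card L\<^sub>\<alpha> ^ k\<close> cancels. Multiplying by
  \<open>card P\<close> keeps the identity within the natural numbers.\<close>

lemma card_regular_suborbits_product_action:
  "card (regular_suborbits W ({1..k} \<rightarrow>\<^sub>E \<Gamma>) (product_action {1..k} \<Gamma>) (\<lambda>i\<in>{1..k}. \<alpha>)) * card P =
    (\<Sum>m = distinguishing_number k P..k.
      fact m * (card (regular_suborbits (perm_group \<Gamma> L) \<Gamma> (\<lambda>g. g) \<alpha>) choose m) *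
      num_distinguishing_partitions k P m)"
proof -
  have "card (regular_orbits Y ({1..k} \<rightarrow>\<^sub>E \<Gamma>) (product_action {1..k} \<Gamma>)) * card H =
      card colourings * card L\<^sub>\<alpha> ^ k"
    using Y.card_regular_orbits[OF finite_PiE[OF _ finite_\<Gamma>]]
    by (simp add: order_def regular_points_eq card_regular_points del: one_Y One_nat_def)
  then have "card (regular_orbits Y ({1..k} \<rightarrow>\<^sub>E \<Gamma>) (product_action {1..k} \<Gamma>)) * card P =
      card colourings"
    using card_L\<^sub>\<alpha>_pos by (simp add: card_H)
  then show ?thesis
    by (simp add: card_colourings regular_suborbits_def Y_def H_def X_def L\<^sub>\<alpha>_def)
qed

end

section \<open>Freedom of the base point and the final formula\<close>

text \<open>Serves the degenerate case of empty \<Gamma>, where \<open>SOME\<close> yields no actual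
  base point. There are no orbits at all on an empty set.\<close>

lemma num_regular_suborbits_empty: "num_regular_suborbits G {} \<phi> = 0"
  by (simp add: num_regular_suborbits_def regular_suborbits_def regular_orbits_def orbits_def)

text \<open>The coordinates are moved independently by the base group, with the identity as
  permutation. Transitivity permits replacing the unspecified base point in
  \<open>num_regular_suborbits\<close> by the constant one.\<close>

lemma transitive_action_product_action:
  assumes L: "subgroup L (BijGroup \<Gamma>)" and P: "subgroup P (BijGroup I)"
    and trans: "transitive_action (perm_group \<Gamma> L) \<Gamma> (\<lambda>g. g)"
  shows "transitive_action (wreath_product I (perm_group \<Gamma> L) P) (I \<rightarrow>\<^sub>E \<Gamma>) (product_action I \<Gamma>)"
proof (intro transitive_action.intro transitive_action_axioms.intro group_action_product_action L P)
  fix x y assume x: "x \<in> I \<rightarrow>\<^sub>E \<Gamma>" and y: "y \<in> I \<rightarrow>\<^sub>E \<Gamma>"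
  have "\<forall>i\<in>I. \<exists>g\<in>L. g (x i) = y i"
    using transitive_action.unique_orbit[OF trans] x y by (fastforce simp: perm_group_def)
  then obtain g where g: "\<And>i. i \<in> I \<Longrightarrow> g i \<in> L \<and> g i (x i) = y i" by metis
  have inv_id: "inv_into I (\<lambda>i\<in>I. i) i = i" if "i \<in> I" for i
    by (rule inv_into_f_eq) (use that in \<open>auto simp: inj_on_def\<close>)
  have "(\<lambda>i\<in>I. i) \<in> P" using subgroup.one_closed[OF P] by (simp add: BijGroup_def)
  then have "(\<lambda>i\<in>I. g i, \<lambda>i\<in>I. i) \<in> carrier (wreath_product I (perm_group \<Gamma> L) P)"
    using g by (simp add: wreath_product_def perm_group_def)
  moreover have "product_action I \<Gamma> (\<lambda>i\<in>I. g i, \<lambda>i\<in>I. i) x = y"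
    using x y g by (auto simp: product_action_def fun_eq_iff inv_id PiE_iff extensional_def)
  ultimately show "\<exists>g\<in>carrier (wreath_product I (perm_group \<Gamma> L) P). product_action I \<Gamma> g x = y"
    by blast
qed

theorem theorem4:
  fixes \<Gamma> :: "'a set" and L :: "('a \<Rightarrow> 'a) set" and k :: nat and P :: "(nat \<Rightarrow> nat) set"
  assumes "product_type \<Gamma> L k P"
  shows "real (num_regular_suborbits (wreath_product {1..k} (perm_group \<Gamma> L) P)
                 ({1..k} \<rightarrow>\<^sub>E \<Gamma>) (product_action {1..k} \<Gamma>)) =
         1 / real (card P) *
           (\<Sum>m = distinguishing_number k P..k.
              fact m * real (num_regular_suborbits (perm_group \<Gamma> L) \<Gamma> (\<lambda>g. g) choose m) *
              real (num_distinguishing_partitions k P m))"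
proof -
  have k: "0 < k" and P: "subgroup P (BijGroup {1..k})" and \<Gamma>: "finite \<Gamma>"
    and L: "subgroup L (BijGroup \<Gamma>)"
    and trans: "transitive_action (perm_group \<Gamma> L) \<Gamma> (\<lambda>g. g)"
    using assms by (auto simp: product_type_def primitive_action_def)
  let ?W = "wreath_product {1..k} (perm_group \<Gamma> L) P"
  interpret W: transitive_action ?W "{1..k} \<rightarrow>\<^sub>E \<Gamma>" "product_action {1..k} \<Gamma>"
    by (rule transitive_action_product_action[OF L P trans])
  show ?thesis
  proof (cases "\<Gamma> = {}")
    case True
    \<comment> \<open>For empty \<Gamma> the factor \<open>0 choose m\<close> removes every term
      except m = 0; that one vanishes because a partition of a non-empty set has at least one
      part.\<close>
    have "\<not> (distinguishing_partition k P Q \<and> card Q = 0)" for Q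
    proof
      assume "distinguishing_partition k P Q \<and> card Q = 0"
      then have "partition_on {1..k} Q" "card Q = 0" by (auto simp: distinguishing_partition_def)
      then have "partition_on {1..k} {}" using finite_elements[of "{1..k}" Q] by simp
      then show False using k partition_onD1[of "{1..k}" "{}"] by simp
    qed
    then have "num_distinguishing_partitions k P 0 = card ({} :: nat set set set)"
      unfolding num_distinguishing_partitions_def by (intro arg_cong[of _ _ card]) blast
    then have "(0 choose m) * num_distinguishing_partitions k P m = 0" for m
      by (cases m) simp_all
    moreover have "{1..k} \<rightarrow>\<^sub>E \<Gamma> = {}"
      unfolding PiE_eq_empty_iff using True k by (intro bexI[of _ 1]) auto
    ultimately show ?thesis using True by (auto simp: num_regular_suborbits_empty intro!: sum.neutral)
  next
    case False
    then obtain \<alpha> where \<alpha>: "\<alpha> \<in> \<Gamma>" by blast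
    interpret product_action_base \<Gamma> L k P \<alpha>
      by (rule product_action_base.intro) (fact \<Gamma> L k P \<alpha>)+
    show ?thesis
      \<comment> \<open>The identity of natural numbers is transferred to the reals, where the
        positive \<open>card P\<close> can be divided out.\<close>
      using card_regular_suborbits_product_action[THEN arg_cong, of real] card_P_pos
      by (simp add: W.num_regular_suborbits_eq[OF \<alpha>_const]
          transitive_action.num_regular_suborbits_eq[OF trans \<alpha>] field_simps
          del: One_nat_def)
  qed
qed

end
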